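(* Let $\tau>0$ and $$H_\tau(u,w,c)=\mu\ln\left(\int_\Xi e^{\frac{F_\tau(x,u,w,c)}{\mu}}p(x)\,\mathrm{d}x\right).$$ For any $\kappa\in(0,1)$ and $u_i,w_i\ge 0$, $c_i\in\mathfrak{C}$ ($i=1,2$) with $(u_1,w_1,c_1)\ne(u_2,w_2,c_2)$, $$H_\tau(\kappa u_1+(1-\kappa)u_2,\ \kappa w_1+(1-\kappa)w_2,\ \kappa c_1+(1-\kappa)c_2)<\kappa H_\tau(u_1,w_1,c_1)+(1-\kappa)H_\tau(u_2,w_2,c_2).$$ Thereby, the regularized optimization problem $$W_\tau=\inf_{u,w\ge 0,\ c\in\mathfrak{C}}\left\{-\lambda u+\eta w+H_\tau(u,w,c)\right\}$$ has a strictly convex objective and admits a unique minimizer, which lies in $D\times\mathfrak{C}$ for some compact set $D\subset[0,+\infty)^2$.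
   Context: Fix $\underline{X}\ge 0$ and $\Xi=(\underline{X},+\infty)$; $p$ is a bounded continuous probability density function that is positive on $\Xi$, with $\int_\Xi p(x)\,\mathrm{d}x=1$. $L_p^2(\Xi)$ is the Hilbert space with norm $\|c\|=\sqrt{\int_\Xi c^2(x)p(x)\,\mathrm{d}x}$, and $\mathfrak{C}=\{c:\Xi\to[0,1]\ \text{measurable},\ c\in L_p^2(\Xi)\}$, whose elements are identified when equal almost everywhere. Constants: $\alpha,\beta\in(0,1)$, $\hat{c}\in[0,1]$, $\lambda,\eta\ge 0$, $\mu>0$. The function $g:[0,1]\to[0,+\infty)$ is twice continuously differentiable, increasing, strictly convex and Lipschitz continuous. The regularized "max" function is $m_\tau(y)=\frac{y+\sqrt{y^2+4\tau^2}}{2}$, $y\in\mathbb{R}$, and $$F_\tau(x,u,w,c)=g(|c(x)-\hat{c}|)+\frac{\lambda}{\alpha}m_\tau(u-(1-c(x))x)+\frac{\eta}{1-\beta}m_\tau((1-c(x))x-w).$$ Standing assumption: $C_X=\frac{2\eta}{\mu(1-\beta)}>0$ is small enough that $\int_\Xi x^k e^{C_X x}p(x)\,\mathrm{d}x<+\infty$ for $k=0,1,2$.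
   Formalization: The formal theorem assumes λ > 0 instead of λ ≥ 0: for λ = 0 neither F_τ nor the objective depends on u, so points differing only in u give equality and the minimizer is not unique, making the claim false there. *)

theory Defs
  imports "HOL-Analysis.Analysis"
begin

definition Xi :: "real \<Rightarrow> real set" where
  "Xi X = {X<..}"

text \<open>Functions on \<open>Xi X\<close> are total functions on the reals of which only the values on
  \<open>Xi X\<close> are used.\<close>

definition L2p :: "real \<Rightarrow> (real \<Rightarrow> real) \<Rightarrow> (real \<Rightarrow> real) set" where
  "L2p X p = {c. c \<in> borel_measurable (lebesgue_on (Xi X)) \<and>
                 integrable (lebesgue_on (Xi X)) (\<lambda>x. (c x)\<^sup>2 * p x)}"

definition Cset :: "real \<Rightarrow> (real \<Rightarrow> real) \<Rightarrow> (real \<Rightarrow> real) set" where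
  "Cset X p = {c \<in> L2p X p. \<forall>x\<in>Xi X. c x \<in> {0..1}}"

text \<open>Equality of elements of \<open>L2p X p\<close>. Null sets of Lebesgue measure on \<open>Xi X\<close> and of the
  measure with density \<open>p\<close> coincide because \<open>p\<close> is positive there.\<close>

definition eq_ae :: "real \<Rightarrow> (real \<Rightarrow> real) \<Rightarrow> (real \<Rightarrow> real) \<Rightarrow> bool" where
  "eq_ae X c d \<longleftrightarrow> (AE x in lebesgue_on (Xi X). c x = d x)"

definition eq_point ::
    "real \<Rightarrow> real \<times> real \<times> (real \<Rightarrow> real) \<Rightarrow> real \<times> real \<times> (real \<Rightarrow> real) \<Rightarrow> bool" where
  "eq_point X = (\<lambda>(u1, w1, c1) (u2, w2, c2). u1 = u2 \<and> w1 = w2 \<and> eq_ae X c1 c2)"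

definition strictly_convex_on :: "'a::real_vector set \<Rightarrow> ('a \<Rightarrow> real) \<Rightarrow> bool" where
  "strictly_convex_on S f \<longleftrightarrow> convex S \<and>
     (\<forall>x\<in>S. \<forall>y\<in>S. \<forall>t\<in>{0<..<1}. x \<noteq> y \<longrightarrow>
        f (t *\<^sub>R x + (1 - t) *\<^sub>R y) < t * f x + (1 - t) * f y)"

text \<open>Derivatives are taken within \<open>S\<close>, hence one-sided at the end points of an interval.\<close>

definition twice_cont_diff_on :: "real set \<Rightarrow> (real \<Rightarrow> real) \<Rightarrow> bool" where
  "twice_cont_diff_on S f \<longleftrightarrow> (\<exists>f' f''.
     (\<forall>x\<in>S. (f has_real_derivative f' x) (at x within S)) \<and>
     (\<forall>x\<in>S. (f' has_real_derivative f'' x) (at x within S)) \<and>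
     continuous_on S f'')"

definition m_reg :: "real \<Rightarrow> real \<Rightarrow> real" where
  "m_reg \<tau> y = (y + sqrt (y\<^sup>2 + 4 * \<tau>\<^sup>2)) / 2"

definition F_reg ::
    "(real \<Rightarrow> real) \<Rightarrow> real \<Rightarrow> real \<Rightarrow> real \<Rightarrow> real \<Rightarrow> real \<Rightarrow> real \<Rightarrow>
     real \<Rightarrow> real \<Rightarrow> real \<Rightarrow> (real \<Rightarrow> real) \<Rightarrow> real" where
  "F_reg g chat lam \<alpha> \<eta> \<beta> \<tau> x u w c =
     g \<bar>c x - chat\<bar>
     + lam / \<alpha> * m_reg \<tau> (u - (1 - c x) * x)
     + \<eta> / (1 - \<beta>) * m_reg \<tau> ((1 - c x) * x - w)"

text \<open>For \<open>u, w \<ge> 0\<close> and \<open>c \<in> Cset X p\<close> the integrand is bounded by a constant multiple of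
  \<open>exp (\<eta> / (\<mu> * (1 - \<beta>)) * x) * p x\<close>, since \<open>m_reg \<tau> y \<le> max y 0 + \<tau>\<close>. Under the
  moment assumption of the theorem the Bochner integral below is therefore a genuine, positive
  integral.\<close>

definition H_reg ::
    "real \<Rightarrow> (real \<Rightarrow> real) \<Rightarrow> real \<Rightarrow> (real \<Rightarrow> real) \<Rightarrow> real \<Rightarrow> real \<Rightarrow> real \<Rightarrow> real \<Rightarrow> real \<Rightarrow> real \<Rightarrow>
     real \<Rightarrow> real \<Rightarrow> (real \<Rightarrow> real) \<Rightarrow> real" where
  "H_reg X p \<mu> g chat lam \<alpha> \<eta> \<beta> \<tau> u w c =
     \<mu> * ln (LINT x|lebesgue_on (Xi X).
              exp (F_reg g chat lam \<alpha> \<eta> \<beta> \<tau> x u w c / \<mu>) * p x)"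

definition objective ::
    "real \<Rightarrow> (real \<Rightarrow> real) \<Rightarrow> real \<Rightarrow> (real \<Rightarrow> real) \<Rightarrow> real \<Rightarrow> real \<Rightarrow> real \<Rightarrow> real \<Rightarrow> real \<Rightarrow> real \<Rightarrow>
     real \<times> real \<times> (real \<Rightarrow> real) \<Rightarrow> real" where
  "objective X p \<mu> g chat lam \<alpha> \<eta> \<beta> \<tau> = (\<lambda>(u, w, c).
     - lam * u + \<eta> * w + H_reg X p \<mu> g chat lam \<alpha> \<eta> \<beta> \<tau> u w c)"

definition feasible :: "real \<Rightarrow> (real \<Rightarrow> real) \<Rightarrow> (real \<times> real \<times> (real \<Rightarrow> real)) set" where
  "feasible X p = {0..} \<times> {0..} \<times> Cset X p"

definition W_reg ::
    "real \<Rightarrow> (real \<Rightarrow> real) \<Rightarrow> real \<Rightarrow> (real \<Rightarrow> real) \<Rightarrow> real \<Rightarrow> real \<Rightarrow> real \<Rightarrow> real \<Rightarrow> real \<Rightarrow> real \<Rightarrow>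
     real" where
  "W_reg X p \<mu> g chat lam \<alpha> \<eta> \<beta> \<tau> =
     (INF z\<in>feasible X p. objective X p \<mu> g chat lam \<alpha> \<eta> \<beta> \<tau> z)"

definition minimizer ::
    "real \<Rightarrow> (real \<Rightarrow> real) \<Rightarrow> real \<Rightarrow> (real \<Rightarrow> real) \<Rightarrow> real \<Rightarrow> real \<Rightarrow> real \<Rightarrow> real \<Rightarrow> real \<Rightarrow> real \<Rightarrow>
     real \<times> real \<times> (real \<Rightarrow> real) \<Rightarrow> bool" where
  "minimizer X p \<mu> g chat lam \<alpha> \<eta> \<beta> \<tau> =
     is_arg_min (objective X p \<mu> g chat lam \<alpha> \<eta> \<beta> \<tau>) (\<lambda>z. z \<in> feasible X p)"

end

theory Submission
  imports Defs
begin

text \<open>Strict convexity: the integrand \<open>F\<close> is pointwise strictly convex in \<open>(u, w, c x)\<close>, and the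
  weighted AM-GM inequality, applied after normalising both exponential integrals to \<open>1\<close>, gives
  Hoelder's inequality for \<open>H\<close>, with a strict inequality as soon as the points differ on a set of
  positive measure.

  Existence needs no weak compactness, because \<open>F\<close> depends on \<open>c\<close> only through \<open>c x\<close>. For given
  \<open>(u, w)\<close> an optimal \<open>c\<close> is found by minimising \<open>F\<close> over \<open>c x \<in> {0..1}\<close> separately for each \<open>x\<close>.
  The minimiser is unique, hence continuous in \<open>(x, u, w)\<close>. What remains is a continuous function
  of \<open>(u, w)\<close>, and it is coercive since \<open>F \<ge> lam / \<alpha> * (u - x)\<close> with \<open>\<alpha> < 1\<close>.\<close>

section \<open>Strict convexity\<close>

lemma strictly_convex_onD:
  assumes "strictly_convex_on S f" "x \<in> S" "y \<in> S" "t \<in> {0<..<1}" "x \<noteq> y"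
  shows "f (t *\<^sub>R x + (1 - t) *\<^sub>R y) < t * f x + (1 - t) * f y"
  using assms by (auto simp: strictly_convex_on_def)

lemma strictly_convex_on_le:
  assumes "strictly_convex_on S f" "x \<in> S" "y \<in> S" "t \<in> {0<..<1}"
  shows "f (t *\<^sub>R x + (1 - t) *\<^sub>R y) \<le> t * f x + (1 - t) * f y"
proof (cases "x = y")
  case True
  then show ?thesis
    by (simp add: scaleR_left_distrib[symmetric] distrib_right[symmetric])
next
  case False
  then show ?thesis
    using strictly_convex_onD[OF assms] by simp
qed

text \<open>The value at the midpoint is at least \<open>f x\<close> by monotonicity and strictly
  below the mean of the two end values by strict convexity.\<close>

lemma strictly_convex_mono_imp_strict_mono:
  fixes f :: "real \<Rightarrow> real"
  assumes "strictly_convex_on S f" "mono_on S f" "x \<in> S" "y \<in> S" "x < y"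
  shows "f x < f y"
proof -
  let ?m = "(1/2) *\<^sub>R x + (1 - 1/2) *\<^sub>R y"
  have "?m \<in> S"
    using assms by (intro convexD) (auto simp: strictly_convex_on_def)
  then have "f x \<le> f ?m"
    using assms by (intro mono_onD[OF assms(2)]) auto
  also have "\<dots> < 1/2 * f x + (1 - 1/2) * f y"
    using assms by (intro strictly_convex_onD) auto
  finally show ?thesis
    by simp
qed

text \<open>Convexity is that of an increasing convex function composed with the convex distance to
  \<open>c\<close>. If the two distances differ, strictness comes from \<open>g\<close> itself. If
  they agree, \<open>x\<close> and \<open>y\<close> are mirror images about \<open>c\<close>; the
  distance of the convex combination is then scaled by \<open>\<bar>2 * t - 1\<bar> < 1\<close>, and
  strict monotonicity of \<open>g\<close> takes over.\<close>

lemma strictly_convex_on_abs_diff: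
  fixes g :: "real \<Rightarrow> real"
  assumes g: "strictly_convex_on {0..1} g" "mono_on {0..1} g" and c: "c \<in> {0..1}"
  shows "strictly_convex_on {0..1} (\<lambda>t. g \<bar>t - c\<bar>)"
  unfolding strictly_convex_on_def
proof (intro conjI ballI impI)
  show "convex {0..1::real}"
    by simp
next
  fix x y t :: real
  assume x: "x \<in> {0..1}" and y: "y \<in> {0..1}" and t: "t \<in> {0<..<1}" and "x \<noteq> y"
  let ?z = "t *\<^sub>R x + (1 - t) *\<^sub>R y" and ?a = "t *\<^sub>R \<bar>x - c\<bar> + (1 - t) *\<^sub>R \<bar>y - c\<bar>"
  have eq: "?z - c = t * (x - c) + (1 - t) * (y - c)"
    by (simp add: algebra_simps)
  have le: "\<bar>?z - c\<bar> \<le> ?a"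
    unfolding eq using t by (intro order_trans[OF abs_triangle_ineq]) (simp add: abs_mult)
  have z: "\<bar>?z - c\<bar> \<in> {0..1}"
  proof -
    have "?z \<in> {0..1}"
      using x y t by (intro convexD) auto
    then show ?thesis
      using c by auto
  qed
  have xc: "\<bar>x - c\<bar> \<in> {0..1}" and yc: "\<bar>y - c\<bar> \<in> {0..1}"
    using x y c by auto
  have a: "?a \<in> {0..1}"
    using xc yc t by (intro convexD) auto
  show "g \<bar>?z - c\<bar> < t * g \<bar>x - c\<bar> + (1 - t) * g \<bar>y - c\<bar>"
  proof (cases "\<bar>x - c\<bar> = \<bar>y - c\<bar>")
    case True
    with \<open>x \<noteq> y\<close> have opp: "y - c = - (x - c)" "x \<noteq> c"
      by (auto simp: abs_if split: if_splits)
    have "\<bar>?z - c\<bar> = \<bar>2 * t - 1\<bar> * \<bar>x - c\<bar>"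
      unfolding eq opp abs_mult[symmetric] by (simp add: algebra_simps)
    also have "\<dots> < 1 * \<bar>x - c\<bar>"
      using t opp by (intro mult_strict_right_mono) auto
    finally have "g \<bar>?z - c\<bar> < g \<bar>x - c\<bar>"
      using z xc by (intro strictly_convex_mono_imp_strict_mono[OF g]) auto
    then show ?thesis
      using True by (simp add: algebra_simps)
  next
    case False
    have "g \<bar>?z - c\<bar> \<le> g ?a"
      using mono_onD[OF g(2) z a le] .
    also have "\<dots> < t * g \<bar>x - c\<bar> + (1 - t) * g \<bar>y - c\<bar>"
      using strictly_convex_onD[OF g(1) xc yc t False] .
    finally show ?thesis .
  qed
qed

section \<open>The regularized positive part\<close>

lemma m_reg_ge: "max y 0 \<le> m_reg \<tau> y"
proof -
  have "\<bar>y\<bar> \<le> sqrt (y\<^sup>2 + 4 * \<tau>\<^sup>2)"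
    by (intro real_le_rsqrt) simp
  then show ?thesis
    by (simp add: m_reg_def)
qed

lemma m_reg_le:
  assumes "0 \<le> \<tau>"
  shows "m_reg \<tau> y \<le> max y 0 + \<tau>"
proof -
  have "sqrt (y\<^sup>2 + 4 * \<tau>\<^sup>2) \<le> \<bar>y\<bar> + 2 * \<tau>"
    using assms by (intro real_le_lsqrt) (auto simp: power2_eq_square algebra_simps)
  then show ?thesis
    by (auto simp: m_reg_def)
qed

lemma continuous_on_m_reg [continuous_intros]:
  "continuous_on S f \<Longrightarrow> continuous_on S (\<lambda>x. m_reg \<tau> (f x))"
  unfolding m_reg_def by (intro continuous_intros) auto

text \<open>Up to a linear term, \<open>m_reg \<tau> y\<close> is half the Euclidean norm of the
  vector \<open>(y, 2 * \<tau>)\<close>. Two such vectors with different first entries are not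
  parallel, so the Cauchy-Schwarz and triangle inequalities are strict for them.\<close>

lemma strictly_convex_on_m_reg:
  assumes "0 < \<tau>"
  shows "strictly_convex_on UNIV (m_reg \<tau>)"
  unfolding strictly_convex_on_def
proof (intro conjI ballI impI)
  fix a b t :: real
  assume t: "t \<in> {0<..<1}" and "a \<noteq> b"
  define d where "d = 2 * \<tau>"
  define A where "A = sqrt (a\<^sup>2 + d\<^sup>2)"
  define B where "B = sqrt (b\<^sup>2 + d\<^sup>2)"
  have d: "0 < d"
    using assms by (simp add: d_def)
  have A2: "A\<^sup>2 = a\<^sup>2 + d\<^sup>2" and B2: "B\<^sup>2 = b\<^sup>2 + d\<^sup>2"
    by (auto simp: A_def B_def)
  \<comment> \<open>Lagrange's identity: the defect in Cauchy-Schwarz is the square of the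
    determinant \<open>d * (a - b)\<close>.\<close>
  have "(a * b + d\<^sup>2)\<^sup>2 < (a * b + d\<^sup>2)\<^sup>2 + (d * (a - b))\<^sup>2"
    using d \<open>a \<noteq> b\<close> by simp
  also have "\<dots> = (A * B)\<^sup>2"
    unfolding power_mult_distrib A2 B2 by (simp add: power2_eq_square algebra_simps)
  finally have AB: "a * b + d\<^sup>2 < A * B"
    by (rule power2_less_imp_less) (simp add: A_def B_def)
  have "(t * a + (1 - t) * b)\<^sup>2 + d\<^sup>2
      = t\<^sup>2 * A\<^sup>2 + (1 - t)\<^sup>2 * B\<^sup>2 + 2 * (t * (1 - t)) * (a * b + d\<^sup>2)"
    unfolding A2 B2 by (simp add: power2_eq_square algebra_simps)
  also have "\<dots> < t\<^sup>2 * A\<^sup>2 + (1 - t)\<^sup>2 * B\<^sup>2 + 2 * (t * (1 - t)) * (A * B)"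
    using AB t by simp
  also have "\<dots> = (t * A + (1 - t) * B)\<^sup>2"
    by (simp add: power2_eq_square algebra_simps)
  finally have "sqrt ((t * a + (1 - t) * b)\<^sup>2 + d\<^sup>2) < t * A + (1 - t) * B"
    using t by (intro real_less_lsqrt) (auto simp: A_def B_def)
  then have "m_reg \<tau> (t * a + (1 - t) * b) < (t * a + (1 - t) * b + (t * A + (1 - t) * B)) / 2"
    by (simp add: m_reg_def d_def)
  also have "\<dots> = t * m_reg \<tau> a + (1 - t) * m_reg \<tau> b"
    by (simp add: m_reg_def A_def B_def d_def field_simps)
  finally show "m_reg \<tau> (t *\<^sub>R a + (1 - t) *\<^sub>R b) < t * m_reg \<tau> a + (1 - t) * m_reg \<tau> b"
    by simp
qed simp

section \<open>Exponential integrals\<close>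

text \<open>A nonnegative integrand with integral 0 vanishes almost everywhere, but this one is
  positive almost everywhere. The last assumption says that \<open>M\<close> is not the null
  measure.\<close>

lemma integral_exp_mult_pos:
  fixes f p :: "'a \<Rightarrow> real"
  assumes "integrable M (\<lambda>x. exp (f x) * p x)" "AE x in M. 0 < p x" "\<not> (AE x in M. False)"
  shows "0 < (LINT x|M. exp (f x) * p x)"
proof -
  have nonneg: "AE x in M. 0 \<le> exp (f x) * p x"
    using assms(2) by eventually_elim simp
  have "(LINT x|M. exp (f x) * p x) \<noteq> 0"
  proof
    assume "(LINT x|M. exp (f x) * p x) = 0"
    then have "AE x in M. exp (f x) * p x = 0"
      using integral_nonneg_eq_0_iff_AE[OF assms(1) nonneg] by simp
    with assms(2) have "AE x in M. False"
      by eventually_elim simp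
    with assms(3) show False ..
  qed
  then show ?thesis
    using integral_nonneg_AE[OF nonneg] by simp
qed

text \<open>Strictness comes from the gap between \<open>f\<close> and the convex combination, not
  from the equality case of the AM-GM inequality. Hence \<open>f1\<close> and \<open>f2\<close> may
  well differ by a constant only.\<close>

lemma ln_integral_exp_strict_convex:
  fixes f f1 f2 p :: "'a \<Rightarrow> real"
  assumes int: "integrable M (\<lambda>x. exp (f x) * p x)"
    and int1: "integrable M (\<lambda>x. exp (f1 x) * p x)" and int2: "integrable M (\<lambda>x. exp (f2 x) * p x)"
    and p: "AE x in M. 0 < p x" and t: "t \<in> {0<..<1}"
    and le: "AE x in M. f x \<le> t * f1 x + (1 - t) * f2 x"
    and neq: "\<not> (AE x in M. f x = t * f1 x + (1 - t) * f2 x)"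
  shows "ln (LINT x|M. exp (f x) * p x)
    < t * ln (LINT x|M. exp (f1 x) * p x) + (1 - t) * ln (LINT x|M. exp (f2 x) * p x)"
proof -
  have nonnull: "\<not> (AE x in M. False)"
    using neq by (rule contrapos_nn) (auto elim: eventually_mono)
  define I where "I = (LINT x|M. exp (f x) * p x)"
  define I1 where "I1 = (LINT x|M. exp (f1 x) * p x)"
  define I2 where "I2 = (LINT x|M. exp (f2 x) * p x)"
  have pos: "0 < I" "0 < I1" "0 < I2"
    using integral_exp_mult_pos[OF _ p nonnull] int int1 int2 by (auto simp: I_def I1_def I2_def)
  \<comment> \<open>\<open>exp L\<close> is the weighted geometric mean of \<open>I1\<close> and
    \<open>I2\<close>, which is the bound in Hoelder's inequality.\<close>
  define L where "L = t * ln I1 + (1 - t) * ln I2"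
  let ?h = "\<lambda>x. t * (exp (f1 x) * p x / I1) + (1 - t) * (exp (f2 x) * p x / I2)"
  \<comment> \<open>AM-GM is convexity of \<open>exp\<close> at the normalised exponents
    \<open>f1 x - ln I1\<close> and \<open>f2 x - ln I2\<close>.\<close>
  have amgm: "exp (t * f1 x + (1 - t) * f2 x) / exp L
      \<le> t * (exp (f1 x) / I1) + (1 - t) * (exp (f2 x) / I2)" for x
  proof -
    have "exp (t * f1 x + (1 - t) * f2 x) / exp L
        = exp ((1 - t) *\<^sub>R (f2 x - ln I2) + t *\<^sub>R (f1 x - ln I1))"
      by (simp add: L_def exp_diff[symmetric] algebra_simps)
    also have "\<dots> \<le> (1 - t) * exp (f2 x - ln I2) + t * exp (f1 x - ln I1)"
      using t exp_convex by (intro convex_onD) auto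
    finally show ?thesis
      using pos by (simp add: exp_diff)
  qed
  have le_h: "AE x in M. exp (f x) * p x / exp L \<le> ?h x"
    and strict: "AE x in M. exp (f x) * p x / exp L = ?h x \<longrightarrow> f x = t * f1 x + (1 - t) * f2 x"
  proof -
    have *: "exp (f x) * p x / exp L \<le> ?h x \<and>
        (exp (f x) * p x / exp L = ?h x \<longrightarrow> f x = t * f1 x + (1 - t) * f2 x)"
      if "0 < p x" "f x \<le> t * f1 x + (1 - t) * f2 x" for x
    proof -
      have *: "exp (f x) * p x / exp L \<le> exp (t * f1 x + (1 - t) * f2 x) * p x / exp L"
        using that by (intro divide_right_mono mult_right_mono) auto
      have **: "exp (t * f1 x + (1 - t) * f2 x) * p x / exp L \<le> ?h x"
        using mult_right_mono[OF amgm less_imp_le[OF that(1)]] by (simp add: algebra_simps)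
      \<comment> \<open>Equality of the outer terms collapses the chain \<open>*\<close>,
        \<open>**\<close>; in its first link \<open>p x > 0\<close> cancels and \<open>exp\<close>
        is injective.\<close>
      have "f x = t * f1 x + (1 - t) * f2 x" if "exp (f x) * p x / exp L = ?h x"
      proof -
        have "exp (f x) * p x / exp L = exp (t * f1 x + (1 - t) * f2 x) * p x / exp L"
          using * ** that by linarith
        then show ?thesis
          using \<open>0 < p x\<close> by simp
      qed
      with * ** show ?thesis
        by linarith
    qed
    show "AE x in M. exp (f x) * p x / exp L \<le> ?h x"
      using p le by eventually_elim (use * in blast)
    show "AE x in M. exp (f x) * p x / exp L = ?h x \<longrightarrow> f x = t * f1 x + (1 - t) * f2 x"
      using p le by eventually_elim (use * in blast)
  qed
  have int': "integrable M (\<lambda>x. exp (f x) * p x / exp L)" and inth: "integrable M ?h"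
    using int int1 int2 by auto
  have h1: "(LINT x|M. ?h x) = 1"
    using int1 int2 pos by (simp add: I1_def I2_def)
  \<comment> \<open>Equal integrals would turn \<open>le_h\<close> into an equality almost
    everywhere, which \<open>strict\<close> carries over to the equality excluded by
    \<open>neq\<close>.\<close>
  have "(LINT x|M. exp (f x) * p x / exp L) \<noteq> (LINT x|M. ?h x)"
  proof
    assume "(LINT x|M. exp (f x) * p x / exp L) = (LINT x|M. ?h x)"
    from integral_ineq_eq_0_then_AE[OF le_h int' inth this] strict
    have "AE x in M. f x = t * f1 x + (1 - t) * f2 x"
      by eventually_elim blast
    with neq show False ..
  qed
  moreover have "(LINT x|M. exp (f x) * p x / exp L) \<le> (LINT x|M. ?h x)"
    by (intro integral_mono_AE int' inth le_h)
  ultimately have "I / exp L < 1"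
    using h1 by (simp add: I_def)
  then have "I < exp L"
    by simp
  then have "ln I < L"
    using pos by (metis exp_less_cancel_iff exp_ln)
  then show ?thesis
    by (simp add: L_def I_def I1_def I2_def)
qed

text \<open>A map into a compact set is continuous once its graph is closed. Uniqueness of the
  minimiser makes the graph the intersection, over all competitors \<open>t\<close>, of the closed
  sets on which \<open>f\<close> does not exceed its value at \<open>t\<close>.\<close>

lemma continuous_on_unique_argmin:
  fixes f :: "'a::euclidean_space \<times> 'b::euclidean_space \<Rightarrow> real"
  assumes S: "closed S" and T: "compact T" and f: "continuous_on (S \<times> T) f" and h: "h \<in> S \<rightarrow> T"
    and min: "\<And>z t. z \<in> S \<Longrightarrow> t \<in> T \<Longrightarrow> t \<noteq> h z \<Longrightarrow> f (z, h z) < f (z, t)"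
  shows "continuous_on S h"
proof (rule continuous_from_closed_graph[OF T h])
  have "(\<lambda>z. (z, h z)) ` S = (S \<times> T) \<inter> (\<Inter>t\<in>T. {q \<in> S \<times> T. f q \<le> f (fst q, t)})"
    (is "?L = ?R")
  proof (intro equalityI subsetI)
    fix q assume "q \<in> ?L"
    then show "q \<in> ?R"
      using h min by (force simp: Pi_iff le_less)
  next
    fix q assume q: "q \<in> ?R"
    then obtain z t where zt: "q = (z, t)" "z \<in> S" "t \<in> T"
      by auto
    with q h have "f (z, t) \<le> f (z, h z)"
      by (auto simp: Pi_iff)
    with min[of z t] zt have "t = h z"
      by fastforce
    with zt show "q \<in> ?L"
      by auto
  qed
  moreover have "closed {q \<in> S \<times> T. f q \<le> f (fst q, t)}" if "t \<in> T" for t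
    using S T that
    by (intro continuous_on_closed_Collect_le f continuous_on_compose2[OF f] continuous_intros closed_Times)
       (auto intro: compact_imp_closed)
  ultimately show "closed ((\<lambda>z. (z, h z)) ` S)"
    using S T by (simp add: closed_Int closed_INT closed_Times compact_imp_closed)
qed

section \<open>The regularized problem\<close>

text \<open>With \<open>lam = 0\<close> the objective would not depend on \<open>u\<close>, and
  uniqueness would fail. The exponent in \<open>exp_moment\<close> bounds the growth rate of
  \<open>F / \<mu>\<close> in \<open>x\<close> and is half the constant in the moment assumption of
  the theorem.\<close>

locale regularized_problem =
  fixes X :: real and p :: "real \<Rightarrow> real" and \<mu> :: real and g :: "real \<Rightarrow> real"
    and chat lam \<alpha> \<eta> \<beta> \<tau> :: real
  assumes X_nonneg: "0 \<le> X" and p_pos: "\<And>x. x \<in> Xi X \<Longrightarrow> 0 < p x"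
    and p_density: "has_bochner_integral (lebesgue_on (Xi X)) p 1"
    and \<alpha>: "\<alpha> \<in> {0<..<1}" and \<beta>: "\<beta> < 1" and chat: "chat \<in> {0..1}"
    and lam: "0 < lam" and \<eta>: "0 < \<eta>" and \<mu>: "0 < \<mu>" and \<tau>: "0 < \<tau>"
    and g_nonneg: "\<And>t. t \<in> {0..1} \<Longrightarrow> 0 \<le> g t" and g_cont: "continuous_on {0..1} g"
    and g_mono: "mono_on {0..1} g" and g_convex: "strictly_convex_on {0..1} g"
    and exp_moment: "integrable (lebesgue_on (Xi X)) (\<lambda>x. exp (\<eta> / (\<mu> * (1 - \<beta>)) * x) * p x)"
begin

abbreviation "M \<equiv> lebesgue_on (Xi X)"

abbreviation "F \<equiv> F_reg g chat lam \<alpha> \<eta> \<beta> \<tau>"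

abbreviation "H \<equiv> H_reg X p \<mu> g chat lam \<alpha> \<eta> \<beta> \<tau>"

abbreviation "\<Phi> \<equiv> objective X p \<mu> g chat lam \<alpha> \<eta> \<beta> \<tau>"

section \<open>The underlying measure and the set of controls\<close>

lemma Xi_lebesgue [simp]: "Xi X \<in> sets lebesgue"
  by (simp add: Xi_def)

lemma space_M [simp]: "space M = Xi X"
  by (simp add: space_restrict_space)

lemma AE_p_pos: "AE x in M. 0 < p x"
  using p_pos by (intro AE_I2) simp

text \<open>On a null measure \<open>p\<close> would integrate to 0 instead of 1.\<close>

lemma M_nonnull: "\<not> (AE x in M. False)"
proof
  assume "AE x in M. False"
  then have "(LINT x|M. p x) = 0"
    by (intro integral_eq_zero_AE) (auto elim: eventually_mono)
  then show False
    using has_bochner_integral_integral_eq[OF p_density] by simp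
qed

lemma p_integrable: "integrable M p"
  using p_density by (rule integrable.intros)

lemma p_measurable [measurable]: "p \<in> borel_measurable M"
  using p_integrable by simp

lemma continuous_imp_measurable_M: "continuous_on UNIV f \<Longrightarrow> f \<in> borel_measurable M"
  by (intro continuous_imp_measurable_on_sets_lebesgue) (auto intro: continuous_on_subset)

lemma coeff_pos: "0 < lam / \<alpha>" "0 < \<eta> / (1 - \<beta>)"
  using lam \<eta> \<alpha> \<beta> by auto

lemma CsetD:
  assumes "c \<in> Cset X p"
  shows "c \<in> borel_measurable M" "\<And>x. x \<in> Xi X \<Longrightarrow> c x \<in> {0..1}"
  using assms by (auto simp: Cset_def L2p_def)

text \<open>Square integrability comes for free: the square of \<open>c x\<close> is at most 1, so
  \<open>p\<close> dominates.\<close>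

lemma CsetI:
  assumes [measurable]: "c \<in> borel_measurable M" and c: "\<And>x. x \<in> Xi X \<Longrightarrow> c x \<in> {0..1}"
  shows "c \<in> Cset X p"
proof -
  have "integrable M (\<lambda>x. (c x)\<^sup>2 * p x)"
  proof (rule Bochner_Integration.integrable_bound[OF p_integrable])
    have "norm ((c x)\<^sup>2 * p x) \<le> norm (p x)" if "x \<in> Xi X" for x
    proof -
      have "(c x)\<^sup>2 \<le> 1"
        using c[OF that] by (auto intro: power_le_one)
      then show ?thesis
        by (simp add: abs_mult mult_left_le_one_le)
    qed
    then show "AE x in M. norm ((c x)\<^sup>2 * p x) \<le> norm (p x)"
      by (intro AE_I2) simp
  qed measurable
  then show ?thesis
    using assms by (auto simp: Cset_def L2p_def)
qed

lemma Cset_convex: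
  assumes c: "c1 \<in> Cset X p" "c2 \<in> Cset X p" and t: "t \<in> {0<..<1}"
  shows "(\<lambda>x. t * c1 x + (1 - t) * c2 x) \<in> Cset X p"
proof (rule CsetI)
  show "(\<lambda>x. t * c1 x + (1 - t) * c2 x) \<in> borel_measurable M"
    using CsetD(1)[OF c(1)] CsetD(1)[OF c(2)] by measurable
  show "t * c1 x + (1 - t) * c2 x \<in> {0..1}" if "x \<in> Xi X" for x
    using convexD[of "{0..1::real}" "c1 x" "c2 x" t "1 - t"]
      CsetD(2)[OF c(1) that] CsetD(2)[OF c(2) that] t by auto
qed

lemma F_measurable:
  assumes "c \<in> Cset X p"
  shows "(\<lambda>x. F x u w c) \<in> borel_measurable M"
proof -
  note c = CsetD[OF assms]
  have [measurable]: "c \<in> borel_measurable M" "m_reg \<tau> \<in> borel_measurable borel"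
    "(\<lambda>x. x) \<in> borel_measurable M"
    using c by (auto intro!: borel_measurable_continuous_onI continuous_intros
        continuous_imp_measurable_M)
  \<comment> \<open>Continuity of \<open>g\<close> is assumed on \<open>{0..1}\<close> only, so the
    composition passes through the Borel space restricted to the range of \<open>c\<close>.\<close>
  have "(\<lambda>t. g \<bar>t - chat\<bar>) \<in> borel_measurable (restrict_space borel {0..1})"
    using chat
    by (intro borel_measurable_continuous_on_restrict continuous_on_compose2[OF g_cont]
        continuous_intros) auto
  moreover have "c \<in> measurable M (restrict_space borel {0..1})"
    using c by (intro measurable_restrict_space2) auto
  ultimately have [measurable]: "(\<lambda>x. g \<bar>c x - chat\<bar>) \<in> borel_measurable M"
    by (rule measurable_compose[rotated])
  show "(\<lambda>x. F x u w c) \<in> borel_measurable M"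
    unfolding F_reg_def by measurable
qed

section \<open>Bounds on the integrand\<close>

lemma F_upper:
  assumes x: "x \<in> Xi X" and u: "0 \<le> u" "u \<le> U" and w: "0 \<le> w" and c: "c x \<in> {0..1}"
  shows "F x u w c \<le> g 1 + lam / \<alpha> * (U + \<tau>) + \<eta> / (1 - \<beta>) * \<tau> + \<eta> / (1 - \<beta>) * x"
proof -
  have x0: "0 \<le> x"
    using x X_nonneg by (auto simp: Xi_def)
  have y: "0 \<le> (1 - c x) * x" "(1 - c x) * x \<le> x"
    using c x0 by (auto intro: mult_left_le_one_le)
  have "m_reg \<tau> (u - (1 - c x) * x) \<le> U + \<tau>"
    using m_reg_le[of \<tau> "u - (1 - c x) * x"] \<tau> y u by (auto simp: max_def split: if_splits)
  moreover have "m_reg \<tau> ((1 - c x) * x - w) \<le> x + \<tau>"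
    using m_reg_le[of \<tau> "(1 - c x) * x - w"] \<tau> y w x0 by (auto simp: max_def split: if_splits)
  moreover have "g \<bar>c x - chat\<bar> \<le> g 1"
    using c chat by (intro mono_onD[OF g_mono]) auto
  ultimately have "F x u w c \<le> g 1 + lam / \<alpha> * (U + \<tau>) + \<eta> / (1 - \<beta>) * (x + \<tau>)"
    unfolding F_reg_def using coeff_pos by (intro add_mono mult_left_mono) auto
  then show ?thesis
    by (simp add: distrib_left)
qed

text \<open>Only the \<open>lam\<close> term is kept. Its slope \<open>lam / \<alpha>\<close> in
  \<open>u\<close> exceeds the slope of \<open>- lam * u\<close> in the objective, which is the
  source of coercivity.\<close>

lemma F_lower:
  assumes x: "x \<in> Xi X" and c: "c x \<in> {0..1}"
  shows "lam / \<alpha> * (u - x) \<le> F x u w c"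
proof -
  have "(1 - c x) * x \<le> x"
    using x c X_nonneg by (auto simp: Xi_def intro: mult_left_le_one_le)
  then have "u - x \<le> m_reg \<tau> (u - (1 - c x) * x)"
    using m_reg_ge[of "u - (1 - c x) * x" \<tau>] by auto
  moreover have "0 \<le> g \<bar>c x - chat\<bar>"
    using c chat by (intro g_nonneg) auto
  moreover have "0 \<le> m_reg \<tau> ((1 - c x) * x - w)"
    using m_reg_ge[of "(1 - c x) * x - w" \<tau>] by simp
  ultimately show ?thesis
    unfolding F_reg_def using coeff_pos
    by (smt (verit) mult_left_mono mult_nonneg_nonneg)
qed

text \<open>A dominating function common to all \<open>u\<close> in \<open>{0..U}\<close>, all
  \<open>w \<ge> 0\<close> and all controls. It serves integrability as well as the passage to the
  limit under the integral.\<close>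

definition envelope :: "real \<Rightarrow> real \<Rightarrow> real" where
  "envelope U x = exp ((g 1 + lam / \<alpha> * (U + \<tau>) + \<eta> / (1 - \<beta>) * \<tau>) / \<mu>)
     * (exp (\<eta> / (\<mu> * (1 - \<beta>)) * x) * p x)"

lemma envelope_integrable: "integrable M (envelope U)"
  unfolding envelope_def using exp_moment by simp

lemma exp_F_le_envelope:
  assumes x: "x \<in> Xi X" and "0 \<le> u" "u \<le> U" "0 \<le> w" "c x \<in> {0..1}"
  shows "norm (exp (F x u w c / \<mu>) * p x) \<le> envelope U x"
proof -
  have "exp (F x u w c / \<mu>) \<le>
      exp ((g 1 + lam / \<alpha> * (U + \<tau>) + \<eta> / (1 - \<beta>) * \<tau> + \<eta> / (1 - \<beta>) * x) / \<mu>)"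
    using F_upper[where c = c, OF assms] \<mu> by (simp add: divide_right_mono)
  also have "\<dots> = exp ((g 1 + lam / \<alpha> * (U + \<tau>) + \<eta> / (1 - \<beta>) * \<tau>) / \<mu>)
      * exp (\<eta> / (\<mu> * (1 - \<beta>)) * x)"
    unfolding exp_add[symmetric] by (simp add: add_divide_distrib mult.commute)
  finally show ?thesis
    using p_pos[OF x] by (simp add: envelope_def abs_mult mult.assoc[symmetric] mult_right_mono)
qed

lemma exp_F_integrable:
  assumes "0 \<le> u" "0 \<le> w" "c \<in> Cset X p"
  shows "integrable M (\<lambda>x. exp (F x u w c / \<mu>) * p x)"
proof (rule Bochner_Integration.integrable_bound[OF envelope_integrable])
  have [measurable]: "(\<lambda>x. F x u w c) \<in> borel_measurable M"
    using F_measurable assms by blast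
  show "(\<lambda>x. exp (F x u w c / \<mu>) * p x) \<in> borel_measurable M"
    by measurable
  have "norm (exp (F x u w c / \<mu>) * p x) \<le> norm (envelope u x)" if "x \<in> Xi X" for x
    using exp_F_le_envelope[where c = c, OF that assms(1) order_refl assms(2) CsetD(2)[OF assms(3) that]]
    by auto
  then show "AE x in M. norm (exp (F x u w c / \<mu>) * p x) \<le> norm (envelope u x)"
    by (intro AE_I2) simp
qed

lemma exp_F_integral_pos:
  assumes "0 \<le> u" "0 \<le> w" "c \<in> Cset X p"
  shows "0 < (LINT x|M. exp (F x u w c / \<mu>) * p x)"
  using integral_exp_mult_pos[OF exp_F_integrable[OF assms] AE_p_pos M_nonnull] .

text \<open>For fixed \<open>x\<close>, each of the three terms is a strictly convex function of an
  affine expression in \<open>(u, w, c x)\<close>. Since the weights are positive, equality must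
  hold in each term: the first gives \<open>c1 x = c2 x\<close>, and then the arguments of
  \<open>m_reg\<close> give back \<open>u\<close> and \<open>w\<close>.\<close>

lemma F_convex:
  assumes t: "t \<in> {0<..<1}" and c: "c1 x \<in> {0..1}" "c2 x \<in> {0..1}"
  shows "F x (t * u1 + (1 - t) * u2) (t * w1 + (1 - t) * w2) (\<lambda>x. t * c1 x + (1 - t) * c2 x)
      \<le> t * F x u1 w1 c1 + (1 - t) * F x u2 w2 c2" (is "?l \<le> ?r")
    and "F x (t * u1 + (1 - t) * u2) (t * w1 + (1 - t) * w2) (\<lambda>x. t * c1 x + (1 - t) * c2 x)
        = t * F x u1 w1 c1 + (1 - t) * F x u2 w2 c2 \<Longrightarrow> c1 x = c2 x \<and> u1 = u2 \<and> w1 = w2"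
proof -
  note G = strictly_convex_on_abs_diff[OF g_convex g_mono chat]
  note m = strictly_convex_on_m_reg[OF \<tau>]
  define c where "c = (\<lambda>x. t * c1 x + (1 - t) * c2 x)"
  define u where "u = t * u1 + (1 - t) * u2"
  define w where "w = t * w1 + (1 - t) * w2"
  define a1 where "a1 = u1 - (1 - c1 x) * x"
  define a2 where "a2 = u2 - (1 - c2 x) * x"
  define b1 where "b1 = (1 - c1 x) * x - w1"
  define b2 where "b2 = (1 - c2 x) * x - w2"
  have a: "u - (1 - c x) * x = t *\<^sub>R a1 + (1 - t) *\<^sub>R a2"
    and b: "(1 - c x) * x - w = t *\<^sub>R b1 + (1 - t) *\<^sub>R b2"
    and cx: "c x = t *\<^sub>R c1 x + (1 - t) *\<^sub>R c2 x"
    by (simp_all add: u_def w_def c_def a1_def a2_def b1_def b2_def algebra_simps)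
  define dG where "dG = t * g \<bar>c1 x - chat\<bar> + (1 - t) * g \<bar>c2 x - chat\<bar> - g \<bar>c x - chat\<bar>"
  define da where "da = t * m_reg \<tau> a1 + (1 - t) * m_reg \<tau> a2 - m_reg \<tau> (u - (1 - c x) * x)"
  define db where "db = t * m_reg \<tau> b1 + (1 - t) * m_reg \<tau> b2 - m_reg \<tau> ((1 - c x) * x - w)"
  have gap: "t * F x u1 w1 c1 + (1 - t) * F x u2 w2 c2 - F x u w c
      = dG + lam / \<alpha> * da + \<eta> / (1 - \<beta>) * db"
    unfolding F_reg_def dG_def da_def db_def a1_def a2_def b1_def b2_def
    by (simp add: algebra_simps add_divide_distrib diff_divide_distrib)
  have nonneg: "0 \<le> dG" "0 \<le> da" "0 \<le> db"
    unfolding dG_def da_def db_def a b unfolding cx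
    using strictly_convex_on_le[OF G c t] strictly_convex_on_le[OF m UNIV_I UNIV_I t]
    by (simp_all only: diff_ge_0_iff_ge)
  then have nonneg': "0 \<le> lam / \<alpha> * da" "0 \<le> \<eta> / (1 - \<beta>) * db"
    using coeff_pos by (auto intro!: mult_nonneg_nonneg less_imp_le simp del: times_divide_eq_left)
  then show "?l \<le> ?r"
    using gap nonneg(1) unfolding u_def w_def c_def by linarith
  assume "?l = ?r"
  then have "dG + lam / \<alpha> * da + \<eta> / (1 - \<beta>) * db = 0"
    using gap unfolding u_def w_def c_def by simp
  then have "dG = 0" "lam / \<alpha> * da = 0" "\<eta> / (1 - \<beta>) * db = 0"
    using nonneg nonneg' by linarith+
  then have "dG = 0" "da = 0" "db = 0"
    using coeff_pos by (auto simp del: times_divide_eq_left)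
  then have "c1 x = c2 x" "a1 = a2" "b1 = b2"
    unfolding dG_def da_def db_def a b unfolding cx
    using strictly_convex_onD[OF G c t] strictly_convex_onD[OF m UNIV_I UNIV_I t, of a1 a2]
      strictly_convex_onD[OF m UNIV_I UNIV_I t, of b1 b2]
    by fastforce+
  then show "c1 x = c2 x \<and> u1 = u2 \<and> w1 = w2"
    by (simp add: a1_def a2_def b1_def b2_def)
qed

section \<open>Strict convexity of the entropic term and of the objective\<close>

lemma H_strictly_convex:
  assumes t: "t \<in> {0<..<1}" and uw: "0 \<le> u1" "0 \<le> w1" "0 \<le> u2" "0 \<le> w2"
    and c: "c1 \<in> Cset X p" "c2 \<in> Cset X p"
    and neq: "\<not> eq_point X (u1, w1, c1) (u2, w2, c2)"
  shows "H (t * u1 + (1 - t) * u2) (t * w1 + (1 - t) * w2) (\<lambda>x. t * c1 x + (1 - t) * c2 x)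
      < t * H u1 w1 c1 + (1 - t) * H u2 w2 c2"
proof -
  let ?u = "t * u1 + (1 - t) * u2" and ?w = "t * w1 + (1 - t) * w2"
    and ?c = "\<lambda>x. t * c1 x + (1 - t) * c2 x"
  let ?f = "\<lambda>x. F x ?u ?w ?c / \<mu>" and ?f1 = "\<lambda>x. F x u1 w1 c1 / \<mu>" and ?f2 = "\<lambda>x. F x u2 w2 c2 / \<mu>"
  have scale: "t * ?f1 x + (1 - t) * ?f2 x = (t * F x u1 w1 c1 + (1 - t) * F x u2 w2 c2) / \<mu>" for x
    by (simp add: add_divide_distrib)
  have "ln (LINT x|M. exp (?f x) * p x)
    < t * ln (LINT x|M. exp (?f1 x) * p x) + (1 - t) * ln (LINT x|M. exp (?f2 x) * p x)"
  proof (rule ln_integral_exp_strict_convex[OF _ _ _ AE_p_pos t])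
    show "integrable M (\<lambda>x. exp (?f x) * p x)"
      using uw t Cset_convex[OF c t] by (intro exp_F_integrable) auto
    show "integrable M (\<lambda>x. exp (?f1 x) * p x)" "integrable M (\<lambda>x. exp (?f2 x) * p x)"
      using uw c by (auto intro!: exp_F_integrable)
    show "AE x in M. ?f x \<le> t * ?f1 x + (1 - t) * ?f2 x"
      unfolding scale using \<mu> CsetD(2)[OF c(1)] CsetD(2)[OF c(2)]
      by (intro AE_I2 divide_right_mono F_convex(1)[OF t]) auto
    show "\<not> (AE x in M. ?f x = t * ?f1 x + (1 - t) * ?f2 x)"
    proof
      assume ae: "AE x in M. ?f x = t * ?f1 x + (1 - t) * ?f2 x"
      then have *: "AE x in M. c1 x = c2 x \<and> u1 = u2 \<and> w1 = w2"
        using AE_space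
      proof eventually_elim
        case (elim x)
        then show ?case
          unfolding scale using \<mu> CsetD(2)[OF c(1), of x] CsetD(2)[OF c(2), of x]
          by (intro F_convex(2)[OF t]) auto
      qed
      have "eq_ae X c1 c2"
        unfolding eq_ae_def using * by eventually_elim simp
      \<comment> \<open>Since the controls agree almost everywhere, the points must differ in
        \<open>u\<close> or \<open>w\<close>. The conjunction in \<open>*\<close> is then false at
        every \<open>x\<close>, although it holds almost everywhere.\<close>
      with neq have "\<not> (u1 = u2 \<and> w1 = w2)"
        by (simp add: eq_point_def)
      then have "AE x in M. False"
        using * by (auto elim: eventually_mono)
      with M_nonnull show False ..
    qed
  qed
  then have "\<mu> * ln (LINT x|M. exp (?f x) * p x) < \<mu> *
      (t * ln (LINT x|M. exp (?f1 x) * p x) + (1 - t) * ln (LINT x|M. exp (?f2 x) * p x))"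
    using \<mu> by simp
  then show ?thesis
    unfolding H_reg_def by (simp add: algebra_simps)
qed

lemma objective_strictly_convex:
  assumes "t \<in> {0<..<1}" "0 \<le> u1" "0 \<le> w1" "0 \<le> u2" "0 \<le> w2" "c1 \<in> Cset X p" "c2 \<in> Cset X p"
    and "\<not> eq_point X (u1, w1, c1) (u2, w2, c2)"
  shows "\<Phi> (t * u1 + (1 - t) * u2, t * w1 + (1 - t) * w2, \<lambda>x. t * c1 x + (1 - t) * c2 x)
      < t * \<Phi> (u1, w1, c1) + (1 - t) * \<Phi> (u2, w2, c2)"
  using H_strictly_convex[OF assms] by (simp add: objective_def algebra_simps)

text \<open>The midpoint of two distinct minimizers would be feasible with a smaller value.\<close>

lemma minimizer_unique:
  assumes "minimizer X p \<mu> g chat lam \<alpha> \<eta> \<beta> \<tau> z1" "minimizer X p \<mu> g chat lam \<alpha> \<eta> \<beta> \<tau> z2"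
  shows "eq_point X z1 z2"
proof (rule ccontr)
  assume neq: "\<not> eq_point X z1 z2"
  obtain u1 w1 c1 u2 w2 c2 where z: "z1 = (u1, w1, c1)" "z2 = (u2, w2, c2)"
    by (metis prod_cases3)
  have feas: "0 \<le> u1" "0 \<le> w1" "0 \<le> u2" "0 \<le> w2" "c1 \<in> Cset X p" "c2 \<in> Cset X p"
    using assms by (auto simp: z minimizer_def is_arg_min_linorder feasible_def)
  let ?t = "1 / 2 :: real"
  let ?z = "(?t * u1 + (1 - ?t) * u2, ?t * w1 + (1 - ?t) * w2, \<lambda>x. ?t * c1 x + (1 - ?t) * c2 x)"
  have "?z \<in> feasible X p"
    using feas Cset_convex[of c1 c2 ?t] by (simp add: feasible_def)
  then have "\<Phi> z1 \<le> \<Phi> ?z" "\<Phi> z2 \<le> \<Phi> ?z"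
    using assms by (auto simp: minimizer_def is_arg_min_linorder)
  moreover have "\<Phi> ?z < ?t * \<Phi> z1 + (1 - ?t) * \<Phi> z2"
    unfolding z using feas neq by (intro objective_strictly_convex) (auto simp: z)
  ultimately show False
    by simp
qed

section \<open>Pointwise minimisation over the control\<close>

text \<open>As \<open>F\<close> sees a control only through its value at \<open>x\<close>, the
  constant function \<open>\<lambda>_. t\<close> stands for \<open>c x = t\<close>. Strict convexity
  leaves no freedom to the choice operator, and packing the arguments into one triple lets joint
  continuity be stated.\<close>

definition opt :: "real \<times> real \<times> real \<Rightarrow> real" where
  "opt = (\<lambda>(x, u, w). SOME t. t \<in> {0..1} \<and> (\<forall>s\<in>{0..1}. F x u w (\<lambda>_. t) \<le> F x u w (\<lambda>_. s)))"

lemma F_continuous: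
  "continuous_on (UNIV \<times> {0..1}) (\<lambda>((x, u, w), t). F x u w (\<lambda>_. t))"
proof -
  have *: "continuous_on (UNIV \<times> {0..1}) (\<lambda>q :: (real \<times> real \<times> real) \<times> real. g \<bar>snd q - chat\<bar>)"
    using chat by (intro continuous_on_compose2[OF g_cont] continuous_intros) auto
  show ?thesis
    unfolding F_reg_def case_prod_beta by (intro continuous_intros *)
qed

lemma opt:
  shows opt_range: "opt (x, u, w) \<in> {0..1}"
    and opt_le: "s \<in> {0..1} \<Longrightarrow> F x u w (\<lambda>_. opt (x, u, w)) \<le> F x u w (\<lambda>_. s)"
proof -
  have "continuous_on {0..1} (\<lambda>t. F x u w (\<lambda>_. t))"
    using continuous_on_compose2[OF F_continuous, of "{0..1}" "\<lambda>t. ((x, u, w), t)"]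
    by (simp add: continuous_intros image_subset_iff)
  then have "\<exists>t\<in>{0..1}. \<forall>s\<in>{0..1}. F x u w (\<lambda>_. t) \<le> F x u w (\<lambda>_. s)"
    by (intro continuous_attains_inf) auto
  then have "\<exists>t. t \<in> {0..1} \<and> (\<forall>s\<in>{0..1}. F x u w (\<lambda>_. t) \<le> F x u w (\<lambda>_. s))"
    by blast
  from someI_ex[OF this] show "opt (x, u, w) \<in> {0..1}"
    "s \<in> {0..1} \<Longrightarrow> F x u w (\<lambda>_. opt (x, u, w)) \<le> F x u w (\<lambda>_. s)"
    by (simp_all add: opt_def)
qed

text \<open>If \<open>s\<close> were a second minimiser, the midpoint could not have a smaller
  value, so convexity would hold with equality. The equality case of \<open>F_convex\<close>, with
  the same \<open>u\<close> and \<open>w\<close> on both sides, then gives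
  \<open>s = opt (x, u, w)\<close>.\<close>

lemma opt_less:
  assumes s: "s \<in> {0..1}" "s \<noteq> opt (x, u, w)"
  shows "F x u w (\<lambda>_. opt (x, u, w)) < F x u w (\<lambda>_. s)"
proof (rule ccontr)
  let ?o = "opt (x, u, w)" and ?t = "1 / 2 :: real"
  let ?m = "?t * s + (1 - ?t) * ?o"
  assume "\<not> ?thesis"
  then have eq: "F x u w (\<lambda>_. s) = F x u w (\<lambda>_. ?o)"
    using opt_le[OF s(1), of x u w] by linarith
  have "?m \<in> {0..1}"
    using s(1) opt_range[of x u w] by auto
  then have "F x u w (\<lambda>_. ?o) \<le> F x u w (\<lambda>_. ?m)"
    by (rule opt_le)
  moreover have "?t * u + (1 - ?t) * u = u" "?t * w + (1 - ?t) * w = w"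
    by simp_all
  moreover note F_convex[of ?t "\<lambda>_. s" x "\<lambda>_. ?o" u u w w]
  ultimately have "s = ?o"
    using s(1) opt_range[of x u w] eq by auto
  with s(2) show False ..
qed

lemma opt_continuous: "continuous_on UNIV opt"
proof (rule continuous_on_unique_argmin[OF _ _ F_continuous])
  show "opt \<in> UNIV \<rightarrow> {0..1}"
    by (auto simp del: atLeastAtMost_iff intro!: opt_range)
qed (auto simp: opt_less)

section \<open>The objective reduced to the two real variables\<close>

definition copt :: "real \<Rightarrow> real \<Rightarrow> real \<Rightarrow> real" where
  "copt u w = (\<lambda>x. opt (x, u, w))"

text \<open>Measurability follows from joint continuity of \<open>opt\<close>, so no measurable
  selection argument is required.\<close>

lemma copt_Cset: "copt u w \<in> Cset X p"
proof (rule CsetI)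
  show "copt u w \<in> borel_measurable M"
    unfolding copt_def
    by (intro continuous_imp_measurable_M continuous_on_compose2[OF opt_continuous] continuous_intros) auto
qed (use opt_range in \<open>simp add: copt_def\<close>)

lemma F_copt_le:
  assumes "c x \<in> {0..1}"
  shows "F x u w (copt u w) \<le> F x u w c"
  using opt_le[OF assms, of x u w] by (simp add: copt_def F_reg_def)

lemma objective_copt_le:
  assumes uw: "0 \<le> u" "0 \<le> w" and c: "c \<in> Cset X p"
  shows "\<Phi> (u, w, copt u w) \<le> \<Phi> (u, w, c)"
proof -
  have "exp (F x u w (copt u w) / \<mu>) * p x \<le> exp (F x u w c / \<mu>) * p x" if "x \<in> Xi X" for x
    using F_copt_le[of c x u w] CsetD(2)[OF c that] p_pos[OF that] \<mu>
    by (simp add: divide_right_mono)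
  then have "(LINT x|M. exp (F x u w (copt u w) / \<mu>) * p x) \<le> (LINT x|M. exp (F x u w c / \<mu>) * p x)"
    using uw c copt_Cset by (intro integral_mono exp_F_integrable) auto
  then show ?thesis
    using \<mu> uw c copt_Cset exp_F_integral_pos by (simp add: objective_def H_reg_def)
qed

text \<open>Dominated convergence along sequences: for each \<open>x\<close> the integrand is
  continuous in \<open>(u, w)\<close> because \<open>opt\<close> is.\<close>

lemma objective_copt_continuous:
  "continuous_on ({0..} \<times> {0..}) (\<lambda>(u, w). \<Phi> (u, w, copt u w))"
proof -
  let ?I = "\<lambda>q. LINT x|M. exp (F x (fst q) (snd q) (copt (fst q) (snd q)) / \<mu>) * p x"
  have contF: "continuous_on UNIV (\<lambda>q. F x (fst q) (snd q) (copt (fst q) (snd q)))" for x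
  proof -
    have "continuous_on UNIV
        (\<lambda>q. (\<lambda>((x, u, w), t). F x u w (\<lambda>_. t)) ((x, fst q, snd q), opt (x, fst q, snd q)))"
    proof (rule continuous_on_compose2[OF F_continuous])
      show "continuous_on UNIV (\<lambda>q. ((x, fst q, snd q), opt (x, fst q, snd q)))"
        by (intro continuous_intros continuous_on_compose2[OF opt_continuous]) auto
    qed (use opt_range in auto)
    then show ?thesis
      by (simp add: copt_def F_reg_def case_prod_beta)
  qed
  have "continuous_on ({0..} \<times> {0..}) ?I"
  proof (rule continuous_on_sequentiallyI)
    fix q :: "nat \<Rightarrow> real \<times> real" and a
    assume q: "\<forall>n. q n \<in> {0..} \<times> {0..}" and a: "a \<in> {0..} \<times> {0..}" and lim: "q \<longlonglongrightarrow> a"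
    \<comment> \<open>A bound on \<open>u\<close> along the sequence suffices, since
      \<open>envelope\<close> does not depend on \<open>w\<close>.\<close>
    have "Bseq (\<lambda>n. fst (q n))"
      using tendsto_fst[OF lim] by (intro convergent_imp_Bseq convergentI)
    then obtain U where U: "\<And>n. fst (q n) \<le> U"
      unfolding Bseq_def by (metis abs_le_D1 real_norm_def)
    show "(\<lambda>n. ?I (q n)) \<longlonglongrightarrow> ?I a"
    proof (rule integral_dominated_convergence[where w = "envelope U"])
      have "(\<lambda>x. exp (F x u w (copt u w) / \<mu>) * p x) \<in> borel_measurable M"
        if "0 \<le> u" "0 \<le> w" for u w
        using exp_F_integrable[OF that copt_Cset] by (rule borel_measurable_integrable)
      with q a show "(\<lambda>x. exp (F x (fst a) (snd a) (copt (fst a) (snd a)) / \<mu>) * p x) \<in> borel_measurable M"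
        "\<And>n. (\<lambda>x. exp (F x (fst (q n)) (snd (q n)) (copt (fst (q n)) (snd (q n))) / \<mu>) * p x)
            \<in> borel_measurable M"
        by (auto simp: mem_Times_iff)
      show "integrable M (envelope U)"
        by (rule envelope_integrable)
      have "(\<lambda>n. F x (fst (q n)) (snd (q n)) (copt (fst (q n)) (snd (q n))))
          \<longlonglongrightarrow> F x (fst a) (snd a) (copt (fst a) (snd a))" for x
        using continuous_on_tendsto_compose[OF contF lim] by simp
      then show "AE x in M. (\<lambda>n. exp (F x (fst (q n)) (snd (q n)) (copt (fst (q n)) (snd (q n))) / \<mu>) * p x)
          \<longlonglongrightarrow> exp (F x (fst a) (snd a) (copt (fst a) (snd a)) / \<mu>) * p x"
        using \<mu> by (intro AE_I2 tendsto_intros) auto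
      show "AE x in M. norm (exp (F x (fst (q n)) (snd (q n)) (copt (fst (q n)) (snd (q n))) / \<mu>) * p x)
          \<le> envelope U x" for n
        using q U CsetD(2)[OF copt_Cset]
        by (intro AE_I2 exp_F_le_envelope) (auto simp: mem_Times_iff)
    qed
  qed
  moreover have "0 < ?I q" if "q \<in> {0..} \<times> {0..}" for q
    using that by (intro exp_F_integral_pos copt_Cset) (auto simp: mem_Times_iff)
  ultimately have "continuous_on ({0..} \<times> {0..}) (\<lambda>q. - lam * fst q + \<eta> * snd q + \<mu> * ln (?I q))"
    by (intro continuous_intros) (auto simp: less_imp_neq[symmetric] simp del: mem_Times_iff)
  then show ?thesis
    by (simp add: objective_def H_reg_def case_prod_beta)
qed

text \<open>Inserting \<open>F_lower\<close> into the integral pulls out a factor exponential in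
  \<open>u\<close>, whose logarithm is linear in \<open>u\<close>. The slope
  \<open>lam * (1 / \<alpha> - 1)\<close> is positive because \<open>\<alpha> < 1\<close>; growth in
  \<open>w\<close> comes from the explicit term \<open>\<eta> * w\<close>.\<close>

lemma objective_coercive:
  obtains K where "\<And>u w c. 0 \<le> u \<Longrightarrow> 0 \<le> w \<Longrightarrow> c \<in> Cset X p \<Longrightarrow>
    lam * (1 / \<alpha> - 1) * u + \<eta> * w + K \<le> \<Phi> (u, w, c)"
proof -
  have coef: "0 \<le> lam / (\<alpha> * \<mu>)"
    using lam \<alpha> \<mu> by simp
  let ?J = "LINT x|M. exp (- (lam / (\<alpha> * \<mu>)) * x) * p x"
  have int: "integrable M (\<lambda>x. exp (- (lam / (\<alpha> * \<mu>)) * x) * p x)"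
  proof (rule Bochner_Integration.integrable_bound[OF p_integrable])
    have [measurable]: "(\<lambda>x. x) \<in> borel_measurable M"
      by (intro continuous_imp_measurable_M continuous_intros)
    show "(\<lambda>x. exp (- (lam / (\<alpha> * \<mu>)) * x) * p x) \<in> borel_measurable M"
      by measurable
    have "norm (exp (- (lam / (\<alpha> * \<mu>)) * x) * p x) \<le> norm (p x)" if "x \<in> Xi X" for x
    proof -
      have "0 \<le> lam / (\<alpha> * \<mu>) * x"
        using that X_nonneg coef by (intro mult_nonneg_nonneg) (auto simp: Xi_def)
      then show ?thesis
        by (simp add: abs_mult mult_left_le_one_le)
    qed
    then show "AE x in M. norm (exp (- (lam / (\<alpha> * \<mu>)) * x) * p x) \<le> norm (p x)"
      by (intro AE_I2) simp
  qed
  have J: "0 < ?J"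
    by (rule integral_exp_mult_pos[OF int AE_p_pos M_nonnull])
  show ?thesis
  proof (rule that[of "\<mu> * ln ?J"])
    fix u w :: real and c
    assume uw: "0 \<le> u" "0 \<le> w" and c: "c \<in> Cset X p"
    have "exp (lam / (\<alpha> * \<mu>) * u) * (exp (- (lam / (\<alpha> * \<mu>)) * x) * p x) \<le> exp (F x u w c / \<mu>) * p x"
      if x: "x \<in> Xi X" for x
    proof -
      have "lam / \<alpha> * (u - x) / \<mu> \<le> F x u w c / \<mu>"
        using F_lower[OF x, of c u w] CsetD(2)[OF c x] \<mu> by (intro divide_right_mono) auto
      then have "exp (lam / (\<alpha> * \<mu>) * u + - (lam / (\<alpha> * \<mu>)) * x) \<le> exp (F x u w c / \<mu>)"
        by (simp add: algebra_simps diff_divide_distrib)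
      then show ?thesis
        using p_pos[OF x] unfolding exp_add by (simp add: mult.assoc[symmetric])
    qed
    then have le: "(LINT x|M. exp (lam / (\<alpha> * \<mu>) * u) * (exp (- (lam / (\<alpha> * \<mu>)) * x) * p x))
        \<le> (LINT x|M. exp (F x u w c / \<mu>) * p x)"
      using uw c int by (intro integral_mono exp_F_integrable integrable_mult_right) auto
    have "lam / (\<alpha> * \<mu>) * u + ln ?J = ln (exp (lam / (\<alpha> * \<mu>) * u) * ?J)"
      using J by (simp add: ln_mult)
    also have "\<dots> \<le> ln (LINT x|M. exp (F x u w c / \<mu>) * p x)"
      using le J by (intro ln_mono) auto
    finally have "\<mu> * (lam / (\<alpha> * \<mu>) * u + ln ?J) \<le> H u w c"
      unfolding H_reg_def using \<mu> by (intro mult_left_mono) auto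
    \<comment> \<open>The summand \<open>lam * u\<close> is split off to cancel
      \<open>- lam * u\<close> in the objective.\<close>
    moreover have "\<mu> * (lam / (\<alpha> * \<mu>) * u + ln ?J) = lam * (1 / \<alpha> - 1) * u + lam * u + \<mu> * ln ?J"
      using \<mu> \<alpha> by (simp add: field_simps)
    ultimately show "lam * (1 / \<alpha> - 1) * u + \<eta> * w + \<mu> * ln ?J \<le> \<Phi> (u, w, c)"
      by (simp add: objective_def)
  qed
qed

lemma minimizer_exists:
  obtains U W u w where "u \<in> {0..U}" "w \<in> {0..W}" "minimizer X p \<mu> g chat lam \<alpha> \<eta> \<beta> \<tau> (u, w, copt u w)"
proof -
  obtain K where K: "\<And>u w c. 0 \<le> u \<Longrightarrow> 0 \<le> w \<Longrightarrow> c \<in> Cset X p \<Longrightarrow>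
      lam * (1 / \<alpha> - 1) * u + \<eta> * w + K \<le> \<Phi> (u, w, c)"
    using objective_coercive by blast
  define k where "k = lam * (1 / \<alpha> - 1)"
  have k: "0 < k"
    using lam \<alpha> by (simp add: k_def)
  \<comment> \<open>\<open>R\<close> is the amount by which the value at the origin exceeds the
    constant of coercivity. Beyond \<open>U\<close> or \<open>W\<close> one of the linear terms
    alone is larger than \<open>R\<close>, so no point there beats the origin.\<close>
  define R where "R = \<Phi> (0, 0, copt 0 0) - K"
  define U where "U = R / k"
  define W where "W = R / \<eta>"
  \<comment> \<open>Coercivity at the origin itself; it ensures that the box contains the origin,
    which is the point of comparison.\<close>
  have "0 \<le> R"
    using K[OF order_refl order_refl copt_Cset] by (simp add: R_def)
  then have UW: "0 \<le> U" "0 \<le> W"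
    using k \<eta> by (auto simp: U_def W_def)
  let ?D = "{0..U} \<times> {0..W}"
  have "\<exists>q\<in>?D. \<forall>q'\<in>?D. (\<lambda>(u, w). \<Phi> (u, w, copt u w)) q \<le> (\<lambda>(u, w). \<Phi> (u, w, copt u w)) q'"
    using UW
    by (intro continuous_attains_inf compact_Times continuous_on_subset[OF objective_copt_continuous]) auto
  then obtain u w where uw: "u \<in> {0..U}" "w \<in> {0..W}"
    and min: "\<And>u' w'. u' \<in> {0..U} \<Longrightarrow> w' \<in> {0..W} \<Longrightarrow> \<Phi> (u, w, copt u w) \<le> \<Phi> (u', w', copt u' w')"
    by fastforce
  have "\<Phi> (u, w, copt u w) \<le> \<Phi> (u', w', c)" if feas: "0 \<le> u'" "0 \<le> w'" "c \<in> Cset X p" for u' w' c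
  proof (cases "u' \<le> U \<and> w' \<le> W")
    case True
    then have "\<Phi> (u, w, copt u w) \<le> \<Phi> (u', w', copt u' w')"
      using feas by (intro min) auto
    also have "\<dots> \<le> \<Phi> (u', w', c)"
      using feas by (rule objective_copt_le)
    finally show ?thesis .
  next
    case False
    then have "R < k * u' \<or> R < \<eta> * w'"
      using k \<eta> by (auto simp: U_def W_def field_simps)
    moreover have "0 \<le> k * u'" "0 \<le> \<eta> * w'"
      using feas k \<eta> by simp_all
    ultimately have "R \<le> k * u' + \<eta> * w'"
      by linarith
    then have "\<Phi> (0, 0, copt 0 0) \<le> \<Phi> (u', w', c)"
      using K[OF feas] by (simp add: R_def k_def)
    then show ?thesis
      using min[of 0 0] UW by simp
  qed
  then have "minimizer X p \<mu> g chat lam \<alpha> \<eta> \<beta> \<tau> (u, w, copt u w)"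
    using uw copt_Cset by (auto simp: minimizer_def is_arg_min_linorder feasible_def)
  with uw show ?thesis
    by (rule that)
qed

end

text \<open>Strict convexity is written out for points because \<open>strictly_convex_on\<close>
  tests literal inequality, whereas controls are identified under \<open>eq_ae\<close>. For the same
  reason the minimizer is unique up to \<open>eq_point\<close>.\<close>

theorem proposition7:
  fixes X \<alpha> \<beta> chat lam \<eta> \<mu> \<tau> :: real and p g :: "real \<Rightarrow> real"
  assumes "0 \<le> X"
    and "bounded (p ` Xi X)" and "continuous_on (Xi X) p" and "\<forall>x\<in>Xi X. 0 < p x"
    and "has_bochner_integral (lebesgue_on (Xi X)) p 1"
    and "\<alpha> \<in> {0<..<1}" and "\<beta> \<in> {0<..<1}" and "chat \<in> {0..1}"
    and "0 < lam" and "0 \<le> \<eta>" and "0 < \<mu>"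
    and "\<forall>t\<in>{0..1}. 0 \<le> g t" and "twice_cont_diff_on {0..1} g" and "mono_on {0..1} g"
    and "strictly_convex_on {0..1} g" and "\<exists>L. L-lipschitz_on {0..1} g"
    and "0 < 2 * \<eta> / (\<mu> * (1 - \<beta>))"
    and "\<forall>k\<in>{0, 1, 2::nat}. integrable (lebesgue_on (Xi X))
           (\<lambda>x. x ^ k * exp (2 * \<eta> / (\<mu> * (1 - \<beta>)) * x) * p x)"
    and "0 < \<tau>"
  shows
    "(\<forall>\<kappa>\<in>{0<..<1}. \<forall>u1\<ge>0. \<forall>w1\<ge>0. \<forall>u2\<ge>0. \<forall>w2\<ge>0. \<forall>c1\<in>Cset X p. \<forall>c2\<in>Cset X p.
        \<not> eq_point X (u1, w1, c1) (u2, w2, c2) \<longrightarrow>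
        H_reg X p \<mu> g chat lam \<alpha> \<eta> \<beta> \<tau> (\<kappa> * u1 + (1 - \<kappa>) * u2) (\<kappa> * w1 + (1 - \<kappa>) * w2)
            (\<lambda>x. \<kappa> * c1 x + (1 - \<kappa>) * c2 x)
          < \<kappa> * H_reg X p \<mu> g chat lam \<alpha> \<eta> \<beta> \<tau> u1 w1 c1
            + (1 - \<kappa>) * H_reg X p \<mu> g chat lam \<alpha> \<eta> \<beta> \<tau> u2 w2 c2)
     \<and> (\<forall>\<kappa>\<in>{0<..<1}. \<forall>u1\<ge>0. \<forall>w1\<ge>0. \<forall>u2\<ge>0. \<forall>w2\<ge>0. \<forall>c1\<in>Cset X p. \<forall>c2\<in>Cset X p.
        \<not> eq_point X (u1, w1, c1) (u2, w2, c2) \<longrightarrow>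
        objective X p \<mu> g chat lam \<alpha> \<eta> \<beta> \<tau> (\<kappa> * u1 + (1 - \<kappa>) * u2, \<kappa> * w1 + (1 - \<kappa>) * w2,
            \<lambda>x. \<kappa> * c1 x + (1 - \<kappa>) * c2 x)
          < \<kappa> * objective X p \<mu> g chat lam \<alpha> \<eta> \<beta> \<tau> (u1, w1, c1)
            + (1 - \<kappa>) * objective X p \<mu> g chat lam \<alpha> \<eta> \<beta> \<tau> (u2, w2, c2))
     \<and> (\<exists>D. compact D \<and> D \<subseteq> {0..} \<times> {0..} \<and>
          (\<exists>u w c. (u, w) \<in> D \<and> c \<in> Cset X p
             \<and> minimizer X p \<mu> g chat lam \<alpha> \<eta> \<beta> \<tau> (u, w, c)
             \<and> objective X p \<mu> g chat lam \<alpha> \<eta> \<beta> \<tau> (u, w, c) = W_reg X p \<mu> g chat lam \<alpha> \<eta> \<beta> \<tau>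
             \<and> (\<forall>z. minimizer X p \<mu> g chat lam \<alpha> \<eta> \<beta> \<tau> z \<longrightarrow> eq_point X z (u, w, c))))"
proof -
  have coeff: "0 < \<eta> / (\<mu> * (1 - \<beta>))"
    using assms(17) by simp
  have \<eta>: "0 < \<eta>"
    using assms by (auto simp: zero_less_divide_iff zero_less_mult_iff)
  have p: "integrable (lebesgue_on (Xi X)) p"
    using assms(5) by (rule integrable.intros)
  \<comment> \<open>As \<open>x \<ge> 0\<close> on \<open>Xi X\<close>, halving the exponent can
    only decrease the integrand; the dominating function is the moment with
    \<open>k = 0\<close>.\<close>
  have "integrable (lebesgue_on (Xi X)) (\<lambda>x. exp (\<eta> / (\<mu> * (1 - \<beta>)) * x) * p x)"
  proof (rule Bochner_Integration.integrable_bound)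
    show "integrable (lebesgue_on (Xi X)) (\<lambda>x. exp (2 * \<eta> / (\<mu> * (1 - \<beta>)) * x) * p x)"
      using assms(18)[rule_format, of 0] by simp
    have [measurable]: "(\<lambda>x. x) \<in> borel_measurable (lebesgue_on (Xi X))"
      by (intro continuous_imp_measurable_on_sets_lebesgue continuous_intros) (simp add: Xi_def)
    show "(\<lambda>x. exp (\<eta> / (\<mu> * (1 - \<beta>)) * x) * p x) \<in> borel_measurable (lebesgue_on (Xi X))"
      using borel_measurable_integrable[OF p] by measurable
    have "norm (exp (\<eta> / (\<mu> * (1 - \<beta>)) * x) * p x)
        \<le> norm (exp (2 * \<eta> / (\<mu> * (1 - \<beta>)) * x) * p x)" if "x \<in> Xi X" for x
    proof -
      have "0 \<le> \<eta> / (\<mu> * (1 - \<beta>)) * x"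
        using coeff that \<open>0 \<le> X\<close> by (intro mult_nonneg_nonneg) (auto simp: Xi_def)
      then have "\<eta> / (\<mu> * (1 - \<beta>)) * x \<le> 2 * \<eta> / (\<mu> * (1 - \<beta>)) * x"
        by simp
      then show ?thesis
        unfolding norm_mult by (intro mult_right_mono) auto
    qed
    then show "AE x in lebesgue_on (Xi X). norm (exp (\<eta> / (\<mu> * (1 - \<beta>)) * x) * p x)
        \<le> norm (exp (2 * \<eta> / (\<mu> * (1 - \<beta>)) * x) * p x)"
      by (intro AE_I2) (simp add: space_restrict_space)
  qed
  moreover have "continuous_on {0..1} g"
    using assms(16) lipschitz_on_continuous_on by blast
  ultimately interpret regularized_problem X p \<mu> g chat lam \<alpha> \<eta> \<beta> \<tau>
    using assms(1,4-9,11,12,14,15,19) \<eta> by unfold_locales auto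
  obtain U W u w where uw: "u \<in> {0..U}" "w \<in> {0..W}"
    and min: "minimizer X p \<mu> g chat lam \<alpha> \<eta> \<beta> \<tau> (u, w, copt u w)"
    by (rule minimizer_exists)
  have "W_reg X p \<mu> g chat lam \<alpha> \<eta> \<beta> \<tau> = \<Phi> (u, w, copt u w)"
    unfolding W_reg_def using min
    by (intro cInf_eq_minimum) (auto simp: minimizer_def is_arg_min_linorder)
  then have "\<exists>D. compact D \<and> D \<subseteq> {0..} \<times> {0..} \<and>
      (\<exists>u w c. (u, w) \<in> D \<and> c \<in> Cset X p
         \<and> minimizer X p \<mu> g chat lam \<alpha> \<eta> \<beta> \<tau> (u, w, c)
         \<and> \<Phi> (u, w, c) = W_reg X p \<mu> g chat lam \<alpha> \<eta> \<beta> \<tau>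
         \<and> (\<forall>z. minimizer X p \<mu> g chat lam \<alpha> \<eta> \<beta> \<tau> z \<longrightarrow> eq_point X z (u, w, c)))"
    using uw min copt_Cset minimizer_unique[OF _ min]
    \<comment> \<open>The compact set \<open>D\<close> is the box from the coercivity
      argument.\<close>
    by (intro exI[of _ "{0..U} \<times> {0..W}"] conjI exI[of _ u] exI[of _ w] exI[of _ "copt u w"])
       (auto intro: compact_Times)
  then show ?thesis
    using H_strictly_convex objective_strictly_convex by (intro conjI ballI allI impI) simp_all
qed

end
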